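(* Let $\mathbb{G}$ be a compact Lie group with Laplace--Beltrami operator $\mathcal{L}$, let $p>1$, and let $(u_0,u_1)\in H^1_{\mathcal{L}}(\mathbb{G})\times L^2(\mathbb{G})$ be nonnegative and nontrivial functions. For $\varepsilon>0$, consider the Cauchy problem $$\begin{cases} \partial_t^2 u-\mathcal{L} u+\partial_t u =|u|^p, & x\in \mathbb{G},\ t>0,\\ u(0,x)=\varepsilon u_0(x), & x\in \mathbb{G},\\ \partial_t u(0,x)=\varepsilon u_1(x), & x\in\mathbb{G},\end{cases}$$ and let $u\in \mathcal{C}([0,T),H^1_{\mathcal{L}}(\mathbb{G}))\cap \mathcal{C}^1([0,T),L^2(\mathbb{G}))\cap L^p_{\mathrm{loc}}([0,T)\times\mathbb{G})$ be an energy solution of this problem with lifespan $T=T(\varepsilon)$. Then there exist $\varepsilon_0=\varepsilon_0(u_0,u_1,p)>0$ and a constant $C>0$ independent of $\varepsilon$ such that for any $\varepsilon\in(0,\varepsilon_0]$ the energy solution $u$ blows up in finite time, and its lifespan satisfies the upper bound $$T(\varepsilon)\leqslant C\,\varepsilon^{-(p-1)}.$$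
   Context: $\mathcal{L}$ is the (nonpositive) Laplace--Beltrami operator on the compact Lie group $\mathbb{G}$, which coincides with the Casimir element of the enveloping algebra (i.e. it is taken with respect to a bi-invariant Riemannian metric). $L^q(\mathbb{G})$ is taken with respect to the normalized Haar measure $\mathrm{d}x$. The Sobolev space is $H^1_{\mathcal{L}}(\mathbb{G})=\{f\in L^2(\mathbb{G}):(-\mathcal{L})^{1/2}f\in L^2(\mathbb{G})\}$ with norm $\|f\|_{L^2(\mathbb{G})}+\|(-\mathcal{L})^{1/2}f\|_{L^2(\mathbb{G})}$. Energy solution: given $(u_0,u_1)\in H^1_{\mathcal{L}}(\mathbb{G})\times L^2(\mathbb{G})$, a function $u\in \mathcal{C}([0,T),H^1_{\mathcal{L}}(\mathbb{G}))\cap \mathcal{C}^1([0,T),L^2(\mathbb{G}))\cap L^p_{\mathrm{loc}}([0,T)\times\mathbb{G})$ is an energy solution on $[0,T)$ of the Cauchy problem if $$\begin{aligned}&\int_{\mathbb{G}}\partial_t u(t,x)\psi(t,x)\,\mathrm{d}x-\int_{\mathbb{G}}u(t,x)\psi_s(t,x)\,\mathrm{d}x+\int_{\mathbb{G}}u(t,x)\psi(t,x)\,\mathrm{d}x\\&\quad-\varepsilon\int_{\mathbb{G}}u_1(x)\psi(0,x)\,\mathrm{d}x+\varepsilon\int_{\mathbb{G}}u_0(x)\psi_s(0,x)\,\mathrm{d}x-\varepsilon\int_{\mathbb{G}}u_0(x)\psi(0,x)\,\mathrm{d}x\\&\quad+\int_0^t\int_{\mathbb{G}}u(s,x)\big(\psi_{ss}(s,x)-\mathcal{L}\psi(s,x)-\psi_s(s,x)\big)\,\mathrm{d}x\,\mathrm{d}s=\int_0^t\int_{\mathbb{G}}|u(s,x)|^p\psi(s,x)\,\mathrm{d}x\,\mathrm{d}s\end{aligned}$$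 for every $\psi\in\mathcal{C}^\infty_0([0,T)\times\mathbb{G})$ (smooth with compact support in $[0,T)\times \mathbb{G}$) and every $t\in(0,T)$. Here $\psi_s,\psi_{ss}$ denote the first and second derivatives of $\psi$ in its time variable. The data being nonnegative and nontrivial means that each of $u_0,u_1$ is nonnegative a.e. and not a.e. equal to zero. The lifespan $T(\varepsilon)\in(0,\infty]$ is the maximal existence time of the energy solution $u$, and "$u$ blows up in finite time" means $T(\varepsilon)<\infty$, i.e. $u$ cannot exist as an energy solution for all times. *)

theory Defs
  imports "HOL-Probability.Probability"
begin

section \<open>Smooth functions between normed spaces\<close>

text \<open>Only used for open \<open>S\<close>. In finite dimension, \<open>C_k_on k S f\<close> says that all iterated
  directional derivatives of \<open>f\<close> up to order \<open>k\<close> exist and are continuous on \<open>S\<close>.\<close>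

fun C_k_on :: "nat \<Rightarrow> 'a::real_normed_vector set \<Rightarrow> ('a \<Rightarrow> 'b::real_normed_vector) \<Rightarrow> bool" where
  "C_k_on 0 S f \<longleftrightarrow> continuous_on S f"
| "C_k_on (Suc k) S f \<longleftrightarrow> (\<forall>x\<in>S. f differentiable at x) \<and>
     (\<forall>v. C_k_on k S (\<lambda>x. frechet_derivative f (at x) v))"

definition smooth_on :: "'a::real_normed_vector set \<Rightarrow> ('a \<Rightarrow> 'b::real_normed_vector) \<Rightarrow> bool" where
  "smooth_on S f \<longleftrightarrow> (\<forall>k. C_k_on k S f)"


section \<open>Compact Lie groups\<close>

text \<open>The model space \<open>'e\<close> has sort \<open>{real_inner, heine_borel}\<close>: a real inner product space in
  which bounded sets are relatively compact, that is, a finite-dimensional Euclidean space. Unlike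
  \<open>euclidean_space\<close>, this sort admits dimension 0, hence finite groups.\<close>

type_synonym ('g, 'e) chart = "'g set \<times> ('g \<Rightarrow> 'e)"

definition param :: "('g, 'e) chart \<Rightarrow> 'e \<Rightarrow> 'g" where
  "param c = inv_into (fst c) (snd c)"

definition smooth_atlas ::
  "('g::{second_countable_topology,t2_space}, 'e::{real_inner,heine_borel}) chart set \<Rightarrow> bool" where
  "smooth_atlas A \<longleftrightarrow>
     (\<Union>c\<in>A. fst c) = UNIV \<and>
     (\<forall>c\<in>A. open (fst c) \<and> open (snd c ` fst c) \<and>
        homeomorphism (fst c) (snd c ` fst c) (snd c) (param c)) \<and>
     (\<forall>c\<in>A. \<forall>d\<in>A. smooth_on (snd c ` (fst c \<inter> fst d)) (snd d \<circ> param c))"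

definition compact_lie_group ::
  "('g \<Rightarrow> 'g \<Rightarrow> 'g) \<Rightarrow> 'g \<Rightarrow> ('g \<Rightarrow> 'g) \<Rightarrow>
   ('g::{second_countable_topology,t2_space}, 'e::{real_inner,heine_borel}) chart set \<Rightarrow> bool" where
  "compact_lie_group mul one invs A \<longleftrightarrow>
     Groups.group mul one invs \<and>
     compact (UNIV :: 'g set) \<and>
     smooth_atlas A \<and>
     continuous_on UNIV (\<lambda>(x, y). mul x y) \<and>
     continuous_on UNIV invs \<and>
     (\<forall>b\<in>A. \<forall>c\<in>A. \<forall>d\<in>A.
        smooth_on {(y, z). y \<in> snd b ` fst b \<and> z \<in> snd c ` fst c \<and>
                           mul (param b y) (param c z) \<in> fst d}
                  (\<lambda>(y, z). snd d (mul (param b y) (param c z)))) \<and>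
     (\<forall>c\<in>A. \<forall>d\<in>A.
        smooth_on {y. y \<in> snd c ` fst c \<and> invs (param c y) \<in> fst d}
                  (\<lambda>y. snd d (invs (param c y))))"

definition normalized_haar :: "('g \<Rightarrow> 'g \<Rightarrow> 'g) \<Rightarrow> 'g::topological_space measure \<Rightarrow> bool" where
  "normalized_haar mul M \<longleftrightarrow>
     sets M = sets borel \<and> prob_space M \<and> (\<forall>a. distr M M (mul a) = M)"

definition smooth_fun :: "('g, 'e::{real_inner,heine_borel}) chart set \<Rightarrow> ('g \<Rightarrow> real) \<Rightarrow> bool" where
  "smooth_fun A f \<longleftrightarrow> (\<forall>c\<in>A. smooth_on (snd c ` fst c) (f \<circ> param c))"


section \<open>Bi-invariant Riemannian metrics and the Laplace--Beltrami operator\<close>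

text \<open>A metric is given by its local expressions: \<open>g c x v w\<close> is the scalar product at \<open>x\<close> of the
  tangent vectors whose coordinates in the chart \<open>c\<close> are \<open>v\<close> and \<open>w\<close>.\<close>

type_synonym ('g, 'e) metric = "('g, 'e) chart \<Rightarrow> 'g \<Rightarrow> 'e \<Rightarrow> 'e \<Rightarrow> real"

definition tangent_map ::
  "('g, 'e::{real_inner,heine_borel}) chart \<Rightarrow> ('g, 'e) chart \<Rightarrow> ('g \<Rightarrow> 'g) \<Rightarrow> 'g \<Rightarrow> 'e \<Rightarrow> 'e" where
  "tangent_map c d F x = frechet_derivative (snd d \<circ> F \<circ> param c) (at (snd c x))"

definition preserves_metric ::
  "('g, 'e::{real_inner,heine_borel}) chart set \<Rightarrow> ('g, 'e) metric \<Rightarrow> ('g \<Rightarrow> 'g) \<Rightarrow> bool" where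
  "preserves_metric A g F \<longleftrightarrow>
     (\<forall>c\<in>A. \<forall>d\<in>A. \<forall>x. x \<in> fst c \<longrightarrow> F x \<in> fst d \<longrightarrow>
        (\<forall>v w. g d (F x) (tangent_map c d F x v) (tangent_map c d F x w) = g c x v w))"

text \<open>For \<open>F = id\<close>, \<open>preserves_metric\<close> says that the local expressions transform as a tensor under
  changes of charts.\<close>

definition riemannian_metric ::
  "('g, 'e::{real_inner,heine_borel}) chart set \<Rightarrow> ('g, 'e) metric \<Rightarrow> bool" where
  "riemannian_metric A g \<longleftrightarrow>
     (\<forall>c\<in>A. \<forall>x\<in>fst c. bilinear (g c x) \<and> (\<forall>v w. g c x v w = g c x w v) \<and>
        (\<forall>v. v \<noteq> 0 \<longrightarrow> g c x v v > 0)) \<and>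
     (\<forall>c\<in>A. \<forall>v w. smooth_on (snd c ` fst c) (\<lambda>y. g c (param c y) v w)) \<and>
     preserves_metric A g id"

definition bi_invariant ::
  "('g \<Rightarrow> 'g \<Rightarrow> 'g) \<Rightarrow> ('g, 'e::{real_inner,heine_borel}) chart set \<Rightarrow> ('g, 'e) metric \<Rightarrow> bool" where
  "bi_invariant mul A g \<longleftrightarrow>
     (\<forall>a. preserves_metric A g (\<lambda>x. mul a x) \<and> preserves_metric A g (\<lambda>x. mul x a))"

text \<open>An orthonormal basis of the model space, supplying the coordinates \<open>y\<^sub>i\<close>.\<close>

definition model_basis :: "'e::{real_inner,heine_borel} set" where
  "model_basis = (SOME B. finite B \<and> (\<forall>b\<in>B. norm b = 1) \<and> pairwise orthogonal B \<and> span B = UNIV)"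

text \<open>\<open>sqrt (det (g\<^sub>i\<^sub>j))\<close>; the determinant is written out by the Leibniz formula because the basis
  is a set rather than an index type.\<close>

definition volume_density ::
  "('g, 'e::{real_inner,heine_borel}) metric \<Rightarrow> ('g, 'e) chart \<Rightarrow> 'g \<Rightarrow> real" where
  "volume_density g c x =
     sqrt (\<Sum>\<pi> | \<pi> permutes (model_basis :: 'e set).
             of_int (sign \<pi>) * (\<Prod>b\<in>model_basis. g c x b (\<pi> b)))"

definition gradient ::
  "('g, 'e::{real_inner,heine_borel}) metric \<Rightarrow> ('g, 'e) chart \<Rightarrow> ('g \<Rightarrow> real) \<Rightarrow> 'g \<Rightarrow> 'e" where
  "gradient g c f x = (THE w. \<forall>v. g c x w v = frechet_derivative (f \<circ> param c) (at (snd c x)) v)"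

text \<open>The Laplace--Beltrami operator \<open>div grad f\<close> in local coordinates,
  \<open>\<Sum>\<^sub>i \<partial>\<^sub>i (sqrt (det g) * (grad f)\<^sub>i) / sqrt (det g)\<close>. It is nonpositive. Its value at \<open>x\<close> does
  not depend on the chart around \<open>x\<close> or on \<open>model_basis\<close>.\<close>

definition laplacian_in_chart ::
  "('g, 'e::{real_inner,heine_borel}) metric \<Rightarrow> ('g, 'e) chart \<Rightarrow> ('g \<Rightarrow> real) \<Rightarrow> 'g \<Rightarrow> real" where
  "laplacian_in_chart g c f x =
     (\<Sum>b\<in>model_basis.
        frechet_derivative
          (\<lambda>y. volume_density g c (param c y) * (gradient g c f (param c y) \<bullet> b)) (at (snd c x)) b)
     / volume_density g c x"

definition laplace_beltrami ::
  "('g, 'e::{real_inner,heine_borel}) chart set \<Rightarrow> ('g, 'e) metric \<Rightarrow> ('g \<Rightarrow> real) \<Rightarrow> 'g \<Rightarrow> real" where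
  "laplace_beltrami A g f x = laplacian_in_chart g (SOME c. c \<in> A \<and> x \<in> fst c) f x"


section \<open>The spaces \<open>L\<^sup>2\<close> and \<open>H\<^sup>1\<close>\<close>

text \<open>Elements are functions rather than classes of functions modulo null sets, so the norms below
  are seminorms.\<close>

definition L2_space :: "'g measure \<Rightarrow> ('g \<Rightarrow> real) set" where
  "L2_space M = {f \<in> borel_measurable M. integrable M (\<lambda>x. (f x)\<^sup>2)}"

definition L2_norm :: "'g measure \<Rightarrow> ('g \<Rightarrow> real) \<Rightarrow> real" where
  "L2_norm M f = sqrt (LINT x|M. (f x)\<^sup>2)"

text \<open>\<open>is_sqrt_neg_laplacian A g M f h\<close> says that \<open>h = (-\<L>)\<^sup>1\<^sup>/\<^sup>2 f\<close> in \<open>L\<^sup>2\<close>, the square root being that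
  of the functional calculus: the component of \<open>h\<close> along each eigenfunction of \<open>-\<L>\<close> is that of \<open>f\<close>
  times the square root of the eigenvalue. Eigenfunctions are smooth and span a dense subspace of
  \<open>L\<^sup>2\<close>, so \<open>h\<close> is unique up to null sets.\<close>

definition is_sqrt_neg_laplacian ::
  "('g, 'e::{real_inner,heine_borel}) chart set \<Rightarrow> ('g, 'e) metric \<Rightarrow> 'g measure \<Rightarrow>
   ('g \<Rightarrow> real) \<Rightarrow> ('g \<Rightarrow> real) \<Rightarrow> bool" where
  "is_sqrt_neg_laplacian A g M f h \<longleftrightarrow>
     f \<in> L2_space M \<and> h \<in> L2_space M \<and>
     (\<forall>\<mu>\<ge>0. \<forall>\<phi>. smooth_fun A \<phi> \<and> (\<forall>x. - laplace_beltrami A g \<phi> x = \<mu> * \<phi> x) \<longrightarrow>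
        (LINT x|M. h x * \<phi> x) = sqrt \<mu> * (LINT x|M. f x * \<phi> x))"

definition H1_space ::
  "('g, 'e::{real_inner,heine_borel}) chart set \<Rightarrow> ('g, 'e) metric \<Rightarrow> 'g measure \<Rightarrow>
   ('g \<Rightarrow> real) set" where
  "H1_space A g M = {f \<in> L2_space M. \<exists>h. is_sqrt_neg_laplacian A g M f h}"

definition H1_norm ::
  "('g, 'e::{real_inner,heine_borel}) chart set \<Rightarrow> ('g, 'e) metric \<Rightarrow> 'g measure \<Rightarrow>
   ('g \<Rightarrow> real) \<Rightarrow> real" where
  "H1_norm A g M f = L2_norm M f + L2_norm M (SOME h. is_sqrt_neg_laplacian A g M f h)"


section \<open>Energy solutions and their lifespan\<close>

definition time_interval :: "ereal \<Rightarrow> real set" where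
  "time_interval T = {t. 0 \<le> t \<and> ereal t < T}"

text \<open>\<open>C_space\<close> is \<open>C(I, X)\<close> for the space \<open>X\<close> with seminorm \<open>nrm\<close>; \<open>has_L2_derivative\<close> expresses
  \<open>\<partial>\<^sub>t u = v\<close> on \<open>I\<close> for \<open>L\<^sup>2\<close>-valued functions (one-sided at an endpoint in \<open>I\<close>).\<close>

definition C_space ::
  "real set \<Rightarrow> ('g \<Rightarrow> real) set \<Rightarrow> (('g \<Rightarrow> real) \<Rightarrow> real) \<Rightarrow> (real \<Rightarrow> 'g \<Rightarrow> real) set" where
  "C_space I X nrm = {u. \<forall>t\<in>I. u t \<in> X \<and>
     ((\<lambda>s. nrm (\<lambda>x. u s x - u t x)) \<longlongrightarrow> 0) (at t within I)}"

definition has_L2_derivative ::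
  "'g measure \<Rightarrow> real set \<Rightarrow> (real \<Rightarrow> 'g \<Rightarrow> real) \<Rightarrow> (real \<Rightarrow> 'g \<Rightarrow> real) \<Rightarrow> bool" where
  "has_L2_derivative M I u v \<longleftrightarrow> (\<forall>t\<in>I. u t \<in> L2_space M \<and> v t \<in> L2_space M \<and>
     ((\<lambda>s. L2_norm M (\<lambda>x. (u s x - u t x) / (s - t) - v t x)) \<longlongrightarrow> 0) (at t within I))"

definition Lp_loc :: "'g::topological_space measure \<Rightarrow> real \<Rightarrow> ereal \<Rightarrow> (real \<Rightarrow> 'g \<Rightarrow> real) set" where
  "Lp_loc M p T = {u.
     set_borel_measurable (lborel \<Otimes>\<^sub>M M) (time_interval T \<times> UNIV) (\<lambda>(t, x). u t x) \<and>
     (\<forall>K. compact K \<and> K \<subseteq> time_interval T \<times> UNIV \<longrightarrow>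
        set_integrable (lborel \<Otimes>\<^sub>M M) K (\<lambda>(t, x). \<bar>u t x\<bar> powr p))}"

text \<open>Smooth functions with compact support in \<open>[0,T) \<times> G\<close>. Smoothness up to the boundary \<open>t = 0\<close> is
  expressed by taking \<open>\<psi>\<close> to be smooth on \<open>\<real> \<times> G\<close>; its values at negative times are irrelevant.\<close>

definition test_fun ::
  "('g::topological_space, 'e::{real_inner,heine_borel}) chart set \<Rightarrow> ereal \<Rightarrow>
   (real \<Rightarrow> 'g \<Rightarrow> real) \<Rightarrow> bool" where
  "test_fun A T \<psi> \<longleftrightarrow>
     (\<forall>c\<in>A. smooth_on (UNIV \<times> snd c ` fst c) (\<lambda>(t, y). \<psi> t (param c y))) \<and>
     (\<exists>K. compact K \<and> K \<subseteq> time_interval T \<times> UNIV \<and>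
        (\<forall>t\<ge>0. \<forall>x. (t, x) \<notin> K \<longrightarrow> \<psi> t x = 0))"

text \<open>The derivatives \<open>\<psi>\<^sub>s\<close> and \<open>\<psi>\<^sub>s\<^sub>s\<close> in the time variable.\<close>

definition dt :: "(real \<Rightarrow> 'g \<Rightarrow> real) \<Rightarrow> real \<Rightarrow> 'g \<Rightarrow> real" where
  "dt \<psi> s x = deriv (\<lambda>r. \<psi> r x) s"

definition dtt :: "(real \<Rightarrow> 'g \<Rightarrow> real) \<Rightarrow> real \<Rightarrow> 'g \<Rightarrow> real" where
  "dtt \<psi> = dt (dt \<psi>)"

definition energy_solution ::
  "('g::topological_space, 'e::{real_inner,heine_borel}) chart set \<Rightarrow> ('g, 'e) metric \<Rightarrow> 'g measure \<Rightarrow>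
   real \<Rightarrow> real \<Rightarrow> ('g \<Rightarrow> real) \<Rightarrow> ('g \<Rightarrow> real) \<Rightarrow> ereal \<Rightarrow> (real \<Rightarrow> 'g \<Rightarrow> real) \<Rightarrow> bool" where
  "energy_solution A g M p \<epsilon> u0 u1 T u \<longleftrightarrow>
     0 < T \<and>
     u \<in> C_space (time_interval T) (H1_space A g M) (H1_norm A g M) \<and>
     u \<in> Lp_loc M p T \<and>
     (\<exists>v. v \<in> C_space (time_interval T) (L2_space M) (L2_norm M) \<and>
        has_L2_derivative M (time_interval T) u v \<and>
        (\<forall>\<psi>. test_fun A T \<psi> \<longrightarrow> (\<forall>t. 0 < t \<and> ereal t < T \<longrightarrow>
             (LINT x|M. v t x * \<psi> t x)
           - (LINT x|M. u t x * dt \<psi> t x)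
           + (LINT x|M. u t x * \<psi> t x)
           - \<epsilon> * (LINT x|M. u1 x * \<psi> 0 x)
           + \<epsilon> * (LINT x|M. u0 x * dt \<psi> 0 x)
           - \<epsilon> * (LINT x|M. u0 x * \<psi> 0 x)
           + (LBINT s:{0..t}. LINT x|M.
                u s x * (dtt \<psi> s x - laplace_beltrami A g (\<psi> s) x - dt \<psi> s x))
           = (LBINT s:{0..t}. LINT x|M. \<bar>u s x\<bar> powr p * \<psi> s x))))"

text \<open>The maximal existence time of an energy solution \<open>u\<close> on \<open>[0,T)\<close>: the supremum of the times
  up to which \<open>u\<close> extends as an energy solution (\<open>u\<close> itself being one such extension).\<close>

definition lifespan ::
  "('g::topological_space, 'e::{real_inner,heine_borel}) chart set \<Rightarrow> ('g, 'e) metric \<Rightarrow> 'g measure \<Rightarrow>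
   real \<Rightarrow> real \<Rightarrow> ('g \<Rightarrow> real) \<Rightarrow> ('g \<Rightarrow> real) \<Rightarrow> ereal \<Rightarrow> (real \<Rightarrow> 'g \<Rightarrow> real) \<Rightarrow> ereal" where
  "lifespan A g M p \<epsilon> u0 u1 T u =
     Sup {T'. T \<le> T' \<and> (\<exists>w. energy_solution A g M p \<epsilon> u0 u1 T' w \<and>
                (\<forall>t\<in>time_interval T. AE x in M. w t x = u t x))}"

end

theory Submission
  imports Defs
begin

text \<open>Test-function method: for \<open>1 \<le> R < T\<close> the weak formulation is tested with the spatially constant
  function \<open>\<psi>(s) = f(1 - s/R)\<close>, where \<open>f(x) = e\<^sup>-\<^sup>1\<^sup>/\<^sup>x\<close> for \<open>x > 0\<close> and \<open>0\<close> otherwise. The Laplacian term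
  vanishes, the boundary terms at \<open>s = R\<close> vanish, and those at \<open>s = 0\<close> have a sign since \<open>\<psi>\<close> decreases.
  As \<open>\<bar>\<psi>'' - \<psi>'\<bar> \<le> (C/R) \<psi>\<^sup>1\<^sup>/\<^sup>p\<close>, Young's inequality absorbs the linear term into the nonlinear one and
  leaves \<open>\<epsilon> \<integral>u\<^sub>0 \<le> C' R\<^sup>-\<^sup>1\<^sup>/\<^sup>(\<^sup>p\<^sup>-\<^sup>1\<^sup>)\<close>, which bounds \<open>R\<close>, hence \<open>T\<close>.\<close>

section \<open>Smooth functions that are flat at the origin\<close>

text \<open>Every derivative of e^(-1/x) is a polynomial in 1/x times e^(-1/x). Carrying the
  polynomial \<open>P\<close> along makes the family closed under differentiation;
  \<open>P = 1\<close> is the cut-off profile.\<close>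

definition flat_exp :: "real poly \<Rightarrow> real \<Rightarrow> real" where
  "flat_exp P x = (if x > 0 then poly P (1 / x) * exp (- (1 / x)) else 0)"

lemma flat_pos: "x > 0 \<Longrightarrow> flat_exp P x = poly P (1 / x) * exp (- (1 / x))"
  and flat_nonpos: "x \<le> 0 \<Longrightarrow> flat_exp P x = 0"
  by (simp_all add: flat_exp_def)

text \<open>Induction on the coefficients: one half of the rate \<open>q\<close> pays for the new
  factor y, through y \<le> (2/q) exp(q y/2), and the other half for the remaining
  polynomial.\<close>

lemma poly_le_exp:
  fixes P :: "real poly"
  assumes "q > 0"
  shows "\<exists>C\<ge>0. \<forall>y\<ge>0. \<bar>poly P y\<bar> \<le> C * exp (q * y)"
  using assms
proof (induction P arbitrary: q)
  case 0
  then show ?case by auto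
next
  case (pCons a P)
  obtain C where C: "C \<ge> 0" "\<And>y. y \<ge> 0 \<Longrightarrow> \<bar>poly P y\<bar> \<le> C * exp (q / 2 * y)"
    using pCons.IH[of "q / 2"] pCons.prems by auto
  have "\<bar>poly (pCons a P) y\<bar> \<le> (\<bar>a\<bar> + 2 / q * C) * exp (q * y)" if "y \<ge> 0" for y
  proof -
    have "q / 2 * y \<le> exp (q / 2 * y)"
      using exp_ge_add_one_self[of "q / 2 * y"] by linarith
    then have y: "y \<le> 2 / q * exp (q / 2 * y)"
      using pCons.prems by (simp add: field_simps)
    have "\<bar>poly (pCons a P) y\<bar> \<le> \<bar>a\<bar> + y * \<bar>poly P y\<bar>"
      using that abs_triangle_ineq[of a "y * poly P y"] by (simp add: abs_mult)
    also have "\<dots> \<le> \<bar>a\<bar> * exp (q * y) + (2 / q * exp (q / 2 * y)) * (C * exp (q / 2 * y))"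
    proof (intro add_mono)
      show "\<bar>a\<bar> \<le> \<bar>a\<bar> * exp (q * y)"
        using that pCons.prems mult_left_mono[of 1 "exp (q * y)" "\<bar>a\<bar>"] by simp
      show "y * \<bar>poly P y\<bar> \<le> (2 / q * exp (q / 2 * y)) * (C * exp (q / 2 * y))"
        by (rule mult_mono[OF y C(2)[OF that]]) (use pCons.prems in auto)
    qed
    also have "(2 / q * exp (q / 2 * y)) * (C * exp (q / 2 * y)) = 2 / q * C * exp (q * y)"
      by (simp add: exp_add[symmetric])
    finally show ?thesis by (simp add: algebra_simps)
  qed
  moreover have "\<bar>a\<bar> + 2 / q * C \<ge> 0"
    using C(1) pCons.prems by simp
  ultimately show ?case by blast
qed

text \<open>The power e^(-1/(px)) of the profile exceeds e^(-1/x) by the factor e^((1-1/p)/x), which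
  is large enough near 0 to absorb any polynomial in 1/x. Hence the derivatives of the cut-off are
  controlled by its own power 1/p, as Young's inequality will require.\<close>

lemma flat_le_powr:
  fixes p :: real
  assumes "p > 1"
  shows "\<exists>C\<ge>0. \<forall>x. \<bar>flat_exp P x\<bar> \<le> C * flat_exp 1 x powr (1 / p)"
proof -
  obtain C where C: "C \<ge> 0" "\<And>y. y \<ge> 0 \<Longrightarrow> \<bar>poly P y\<bar> \<le> C * exp ((1 - 1 / p) * y)"
    using poly_le_exp[of "1 - 1 / p" P] assms by auto
  have "\<bar>flat_exp P x\<bar> \<le> C * flat_exp 1 x powr (1 / p)" for x
  proof (cases "x > 0")
    case True
    have "\<bar>flat_exp P x\<bar> \<le> C * exp ((1 - 1 / p) * (1 / x)) * exp (- (1 / x))"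
      using C(2)[of "1 / x"] True by (simp add: flat_pos abs_mult)
    also have "\<dots> = C * exp (- (1 / x) * (1 / p))"
      using True assms by (simp add: exp_add[symmetric] algebra_simps)
    finally show ?thesis using True by (simp add: flat_pos powr_def mult.commute)
  qed (simp add: flat_exp_def)
  with C(1) show ?thesis by blast
qed

lemma flat_tendsto_0: "(flat_exp P \<longlongrightarrow> 0) (at_right 0)"
proof -
  obtain C where C: "C \<ge> 0" "\<And>y. y \<ge> 0 \<Longrightarrow> \<bar>poly P y\<bar> \<le> C * exp (1 / 2 * y)"
    using poly_le_exp[of "1 / 2" P] by auto
  have "((\<lambda>y. poly P y * exp (- y)) \<longlongrightarrow> 0) at_top"
  proof (rule Lim_null_comparison)
    show "\<forall>\<^sub>F y in at_top. norm (poly P y * exp (- y)) \<le> C * exp (- (1 / 2 * y))"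
      using eventually_ge_at_top[of "0 :: real"]
    proof eventually_elim
      case (elim y)
      have "norm (poly P y * exp (- y)) \<le> C * exp (1 / 2 * y) * exp (- y)"
        using C(2)[OF elim] by (simp add: abs_mult)
      also have "\<dots> = C * exp (- (1 / 2 * y))"
        by (simp add: exp_add[symmetric])
      finally show ?case .
    qed
    have "filterlim (\<lambda>y. 1 / 2 * y :: real) at_top at_top"
      by (rule filterlim_tendsto_pos_mult_at_top[OF tendsto_const]) (auto intro: filterlim_ident)
    then have "((\<lambda>y :: real. exp (- (1 / 2 * y))) \<longlongrightarrow> 0) at_top"
      by (intro filterlim_compose[OF exp_at_bot]) (simp add: filterlim_uminus_at_bot)
    then show "((\<lambda>y. C * exp (- (1 / 2 * y))) \<longlongrightarrow> 0) at_top"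
      by (rule tendsto_mult_right_zero)
  qed
  then have "((\<lambda>x. poly P (inverse x) * exp (- inverse x)) \<longlongrightarrow> 0) (at_right 0)"
    by (rule filterlim_compose[OF _ filterlim_inverse_at_top_right])
  moreover have "\<forall>\<^sub>F x in at_right 0. poly P (inverse x) * exp (- inverse x) = flat_exp P x"
    using eventually_at_right_less[of "0 :: real"]
    by eventually_elim (simp add: flat_pos inverse_eq_divide)
  ultimately show ?thesis by (rule Lim_transform_eventually)
qed

text \<open>With y = 1/x one has dy/dx = -y^2, so the derivative of P(y) e^(-y) is y^2 (P(y) -
  P'(y)) e^(-y).\<close>

definition flat_deriv :: "real poly \<Rightarrow> real poly" where
  "flat_deriv P = [:0, 0, 1:] * (P - pderiv P)"

lemma DERIV_flat: "(flat_exp P has_real_derivative flat_exp (flat_deriv P) x) (at x)"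
proof -
  consider "x > 0" | "x < 0" | "x = 0" by linarith
  then show ?thesis
  proof cases
    case 1
    have "((\<lambda>x. poly P (1 / x) * exp (- (1 / x))) has_real_derivative flat_exp (flat_deriv P) x) (at x)"
      using 1 by (auto intro!: derivative_eq_intros simp: flat_pos flat_deriv_def field_simps power2_eq_square)
    then show ?thesis
      by (rule has_field_derivative_transform_within_open[of _ _ _ "{0<..}"]) (use 1 in \<open>auto simp: flat_pos\<close>)
  next
    case 2
    have "((\<lambda>x. 0) has_real_derivative flat_exp (flat_deriv P) x) (at x)"
      using 2 by (simp add: flat_nonpos)
    then show ?thesis
      by (rule has_field_derivative_transform_within_open[of _ _ _ "{..<0}"]) (use 2 in \<open>auto simp: flat_nonpos\<close>)
  next
    case 3
    have "((\<lambda>h. flat_exp P h / h) \<longlongrightarrow> 0) (at_left 0)"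
      by (rule Lim_transform_eventually[OF tendsto_const])
        (auto simp: eventually_at_left_field flat_nonpos intro!: exI[of _ "- 1"])
    \<comment> \<open>For h > 0 the difference quotient at 0 is again a member of the family:
      dividing by h turns \<open>P\<close> into \<open>pCons 0 P\<close>.\<close>
    moreover have "((\<lambda>h. flat_exp P h / h) \<longlongrightarrow> 0) (at_right 0)"
      by (rule Lim_transform_eventually[OF flat_tendsto_0[of "pCons 0 P"]])
        (auto simp: eventually_at_right_field flat_pos intro!: exI[of _ 1])
    ultimately have "((\<lambda>h. flat_exp P h / h) \<longlongrightarrow> 0) (at 0)"
      by (simp add: filterlim_split_at)
    then show ?thesis using 3 by (simp add: DERIV_def flat_nonpos)
  qed
qed

lemma DERIV_flat_scaled:
  "((\<lambda>s. flat_exp P (1 - s / R)) has_real_derivative - flat_exp (flat_deriv P) (1 - s / R) / R) (at s)"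
proof -
  have "((\<lambda>s. 1 - s / R) has_real_derivative - 1 / R) (at s)"
    using DERIV_diff[OF DERIV_const[of 1] DERIV_cdivide[OF DERIV_ident, of R]] by simp
  from DERIV_chain2[OF DERIV_flat this, of P] show ?thesis by simp
qed

lemma smooth_on_flat_fst: "smooth_on S (\<lambda>z :: real \<times> 'e::real_normed_vector. flat_exp P (1 - fst z / R))"
proof -
  \<comment> \<open>The scalar \<open>c\<close> is generalized because differentiating in direction
    v produces the factor \<open>- fst v / R\<close>, constant in z, in front of the function for
    \<open>flat_deriv P\<close>.\<close>
  have "C_k_on k S (\<lambda>z :: real \<times> 'e. c * flat_exp P (1 - fst z / R))" for k c
  proof (induction k arbitrary: c P)
    case 0
    have "continuous_on UNIV (flat_exp P)"
      using DERIV_flat by (meson DERIV_isCont continuous_at_imp_continuous_on)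
    then show ?case
      by (auto intro!: continuous_intros continuous_on_compose2[of UNIV "flat_exp P"] simp: divide_inverse)
  next
    case (Suc k)
    have D: "((\<lambda>z. c * flat_exp P (1 - fst z / R)) has_derivative
        (\<lambda>v. (c * (- fst v / R)) * flat_exp (flat_deriv P) (1 - fst z / R))) (at z)" for z :: "real \<times> 'e"
    proof -
      have "((\<lambda>z. flat_exp P (1 - fst z / R)) has_derivative
          (\<lambda>v. fst v * (- flat_exp (flat_deriv P) (1 - fst z / R) / R))) (at z)"
        using has_derivative_compose[OF has_derivative_fst[OF has_derivative_ident]
          DERIV_flat_scaled[of P R "fst z", unfolded has_field_derivative_def]]
        by (simp add: mult.commute)
      from has_derivative_mult_right[OF this, of c] show ?thesis
        by (simp add: algebra_simps)
    qed
    have "frechet_derivative (\<lambda>z. c * flat_exp P (1 - fst z / R)) (at z) v =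
        (c * (- fst v / R)) * flat_exp (flat_deriv P) (1 - fst z / R)" for z v :: "real \<times> 'e"
      by (simp add: frechet_derivative_at[OF D, symmetric])
    then show ?case
      unfolding C_k_on.simps by (simp only:) (blast intro: differentiableI D Suc.IH)
  qed
  from this[where c = 1] show ?thesis by (simp add: smooth_on_def)
qed

section \<open>The Laplacian of a constant function\<close>

text \<open>The differential of a constant is 0. A vector w representing it satisfies g(w, w) = 0,
  so w = 0 by positive definiteness; this settles the uniqueness behind \<open>THE\<close>.\<close>

lemma gradient_const:
  assumes "riemannian_metric A g" "c \<in> A" "x \<in> fst c"
  shows "gradient g c (\<lambda>_. k) x = 0"
proof -
  have bil: "bilinear (g c x)" and pos: "\<And>v. v \<noteq> 0 \<Longrightarrow> g c x v v > 0"
    using assms unfolding riemannian_metric_def by blast+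
  have "(THE w. \<forall>v. g c x w v = 0) = 0"
    by (rule the_equality) (use bilinear_lzero[OF bil] pos in \<open>force+\<close>)
  then show ?thesis by (simp add: gradient_def comp_def)
qed

text \<open>The gradient vanishes on the whole chart image, which is open, so the vector field
  differentiated in the divergence is locally zero.\<close>

lemma laplace_beltrami_const:
  assumes "smooth_atlas A" "riemannian_metric A g"
  shows "laplace_beltrami A g (\<lambda>_. k) x = 0"
proof -
  define c where "c = (SOME c. c \<in> A \<and> x \<in> fst c)"
  have "\<exists>c. c \<in> A \<and> x \<in> fst c"
    using assms(1) unfolding smooth_atlas_def by blast
  then have c: "c \<in> A" "x \<in> fst c"
    unfolding c_def using someI_ex[of "\<lambda>c. c \<in> A \<and> x \<in> fst c"] by blast+
  have op: "open (snd c ` fst c)"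
    using assms(1) c(1) unfolding smooth_atlas_def by blast
  have "gradient g c (\<lambda>_. k) (param c y) = 0" if "y \<in> snd c ` fst c" for y
    unfolding param_def by (rule gradient_const[OF assms(2) c(1) inv_into_into[OF that]])
  then have "((\<lambda>y. volume_density g c (param c y) * (gradient g c (\<lambda>_. k) (param c y) \<bullet> b))
      has_derivative (\<lambda>_. 0)) (at (snd c x))" for b
    by (intro has_derivative_transform_within_open[OF has_derivative_const[of 0] op]) (use c in auto)
  from frechet_derivative_at[OF this, symmetric] show ?thesis
    by (simp add: laplace_beltrami_def laplacian_in_chart_def c_def[symmetric])
qed

section \<open>The test-function estimate\<close>

text \<open>If b \<le> a^(p-1), the product is at most a^p; otherwise a \<le> b^(1/(p-1)) and the
  second term dominates. The coefficient 1 of a^p is small enough for the nonlinear term to absorb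
  it exactly.\<close>

lemma young_weak:
  fixes a b p :: real
  assumes "p > 1" "a \<ge> 0" "b \<ge> 0"
  shows "a * b \<le> a powr p + b powr (p / (p - 1))"
proof (cases "a = 0 \<or> b = 0")
  case True
  then have "a * b = 0" by simp
  then show ?thesis by (simp only: add_nonneg_nonneg powr_ge_zero)
next
  case False
  with assms have ab: "a > 0" "b > 0" by auto
  show ?thesis
  proof (cases "b \<le> a powr (p - 1)")
    case True
    then have "a * b \<le> a * a powr (p - 1)" using ab by simp
    also have "\<dots> = a powr p" using ab powr_mult_base[of a "p - 1"] by simp
    finally show ?thesis using powr_ge_zero[of b "p / (p - 1)"] by linarith
  next
    case False
    then have "(a powr (p - 1)) powr (1 / (p - 1)) \<le> b powr (1 / (p - 1))"
      using assms by (intro powr_mono2) auto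
    then have "a \<le> b powr (1 / (p - 1))" using ab assms by (simp add: powr_powr)
    then have "a * b \<le> b * b powr (1 / (p - 1))" using ab by (simp add: mult.commute)
    also have "\<dots> = b powr (p / (p - 1))"
      using ab assms powr_mult_base[of b "1 / (p - 1)"] by (simp add: field_simps)
    finally show ?thesis using powr_ge_zero[of a p] by linarith
  qed
qed

lemma (in prob_space) integrable_L2_space:
  assumes "f \<in> L2_space M"
  shows "integrable M f"
  by (rule square_integrable_imp_integrable) (use assms in \<open>simp_all add: L2_space_def\<close>)

lemma normalized_haarD:
  assumes "normalized_haar mul M"
  shows "prob_space M" and "sets M = sets borel"
  using assms by (simp_all only: normalized_haar_def)

text \<open>The core inequality, for one fixed \<open>R\<close> below the existence time. The
  constants \<open>C1\<close> and \<open>C2\<close> are chosen before \<open>\<epsilon>\<close>,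
  \<open>R\<close> and \<open>u\<close>, so the final bound does not depend on these.\<close>

lemma test_function_estimate:
  fixes mul :: "'g::{second_countable_topology,t2_space} \<Rightarrow> 'g \<Rightarrow> 'g"
    and A :: "('g, 'e::{real_inner,heine_borel}) chart set"
    and R p :: real
  assumes atlas: "smooth_atlas A" and cpt: "compact (UNIV :: 'g set)"
    and metric: "riemannian_metric A g"
    and haar: "normalized_haar mul M"
    and p: "p > 1" and \<epsilon>: "\<epsilon> > 0"
    and u0: "AE x in M. 0 \<le> u0 x" and u1: "AE x in M. 0 \<le> u1 x"
    and sol: "energy_solution A g M p \<epsilon> u0 u1 T u"
    and R: "1 \<le> R" "ereal R < T"
    and C1: "C1 \<ge> 0" "\<And>x. \<bar>flat_exp (flat_deriv 1) x\<bar> \<le> C1 * flat_exp 1 x powr (1 / p)"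
    and C2: "C2 \<ge> 0" "\<And>x. \<bar>flat_exp (flat_deriv (flat_deriv 1)) x\<bar> \<le> C2 * flat_exp 1 x powr (1 / p)"
  shows "\<epsilon> * exp (- 1) * (LINT x|M. u0 x) \<le> R * ((C1 + C2) / R) powr (p / (p - 1))"
proof -
  define C where "C = C1 + C2"
  define \<phi> where "\<phi> s = flat_exp 1 (1 - s / R)" for s
  \<comment> \<open>\<open>h\<close> will be \<psi>_ss - \<psi>_s; the second summand is positive in
    front because the inner derivative of 1 - s/R is -1/R.\<close>
  define h where "h s = flat_exp (flat_deriv (flat_deriv 1)) (1 - s / R) / R\<^sup>2
    + flat_exp (flat_deriv 1) (1 - s / R) / R" for s
  define \<psi> where "\<psi> s = (\<lambda>x :: 'g. \<phi> s)" for s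
  have "prob_space M" and sets_M: "sets M = sets borel"
    by (rule normalized_haarD[OF haar])+
  then interpret prob_space M by simp
  note M_sigma_finite = sigma_finite_measure_axioms
  have space_M: "space M = UNIV"
    using sets_eq_imp_space_eq[OF sets_M] by simp
  interpret pair_sigma_finite lborel M ..

  \<comment> \<open>The test function and the weak formulation at time \<open>R\<close>\<close>
  have dt: "dt \<psi> s x = - flat_exp (flat_deriv 1) (1 - s / R) / R" for s x
    unfolding dt_def \<psi>_def \<phi>_def by (rule DERIV_imp_deriv[OF DERIV_flat_scaled])
  have dtt: "dtt \<psi> s x = flat_exp (flat_deriv (flat_deriv 1)) (1 - s / R) / R\<^sup>2" for s x
  proof -
    have "((\<lambda>s. - flat_exp (flat_deriv 1) (1 - s / R) / R) has_real_derivative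
        - (- flat_exp (flat_deriv (flat_deriv 1)) (1 - s / R) / R) / R) (at s)"
      by (intro DERIV_cdivide DERIV_minus DERIV_flat_scaled)
    then show ?thesis
      unfolding dtt_def dt_def[of "dt \<psi>"] dt
      by (subst DERIV_imp_deriv) (auto simp: power2_eq_square)
  qed

  \<comment> \<open>For nonnegative times \<open>\<psi>\<close> is supported in [0,R] \<times> G,
    which is compact since G is and lies below \<open>T\<close> since R < T.\<close>
  have test: "test_fun A T \<psi>"
    unfolding test_fun_def
  proof (intro conjI ballI exI)
    show "smooth_on (UNIV \<times> snd c ` fst c) (\<lambda>(t, y). \<psi> t (param c y))" for c
      using smooth_on_flat_fst[of _ 1 R] by (simp add: \<psi>_def \<phi>_def case_prod_beta')
    show "compact ({0..R} \<times> (UNIV :: 'g set))"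
      using cpt by (intro compact_Times) auto
    show "{0..R} \<times> UNIV \<subseteq> time_interval T \<times> (UNIV :: 'g set)"
      using R(2) by (auto simp: time_interval_def) (meson ereal_less_eq(3) le_less_trans)
    show "\<forall>t\<ge>0. \<forall>x. (t, x) \<notin> {0..R} \<times> UNIV \<longrightarrow> \<psi> t x = 0"
      using R(1) by (auto simp: \<psi>_def \<phi>_def intro!: flat_nonpos)
  qed
  obtain v where "\<forall>\<psi>. test_fun A T \<psi> \<longrightarrow> (\<forall>t. 0 < t \<and> ereal t < T \<longrightarrow>
      (LINT x|M. v t x * \<psi> t x) - (LINT x|M. u t x * dt \<psi> t x) + (LINT x|M. u t x * \<psi> t x)
      - \<epsilon> * (LINT x|M. u1 x * \<psi> 0 x) + \<epsilon> * (LINT x|M. u0 x * dt \<psi> 0 x)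
      - \<epsilon> * (LINT x|M. u0 x * \<psi> 0 x)
      + (LBINT s:{0..t}. LINT x|M. u s x * (dtt \<psi> s x - laplace_beltrami A g (\<psi> s) x - dt \<psi> s x))
      = (LBINT s:{0..t}. LINT x|M. \<bar>u s x\<bar> powr p * \<psi> s x))"
    using sol[unfolded energy_solution_def] by (elim conjE exE)
  from this[rule_format, OF test, of R] R have weak:
    "(LINT x|M. v R x * \<psi> R x) - (LINT x|M. u R x * dt \<psi> R x) + (LINT x|M. u R x * \<psi> R x)
      - \<epsilon> * (LINT x|M. u1 x * \<psi> 0 x) + \<epsilon> * (LINT x|M. u0 x * dt \<psi> 0 x)
      - \<epsilon> * (LINT x|M. u0 x * \<psi> 0 x)
      + (LBINT s:{0..R}. LINT x|M. u s x * (dtt \<psi> s x - laplace_beltrami A g (\<psi> s) x - dt \<psi> s x))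
      = (LBINT s:{0..R}. LINT x|M. \<bar>u s x\<bar> powr p * \<psi> s x)"
    by simp
  have lap: "laplace_beltrami A g (\<psi> s) x = 0" for s x
    unfolding \<psi>_def by (rule laplace_beltrami_const[OF atlas metric])
  \<comment> \<open>Flatness at s = R removes all terms at the final time, including the one with
    the unknown \<partial>_t u. At s = 0 both the profile and its derivative equal e^(-1) at the
    argument 1.\<close>
  have bd: "\<psi> R x = 0" "dt \<psi> R x = 0" "\<psi> 0 x = exp (- 1)" "dt \<psi> 0 x = - exp (- 1) / R" for x
    unfolding dt using R by (simp_all add: \<psi>_def \<phi>_def flat_exp_def flat_deriv_def)
  have h: "dtt \<psi> s x - laplace_beltrami A g (\<psi> s) x - dt \<psi> s x = h s" for s x
    by (simp add: lap dt dtt h_def)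
  have I0: "0 \<le> (LINT x|M. u0 x)" and I1: "0 \<le> (LINT x|M. u1 x)"
    using u0 u1 by (auto intro: integral_nonneg_AE)
  have "(LBINT s:{0..R}. LINT x|M. u s x * h s) - (LBINT s:{0..R}. LINT x|M. \<bar>u s x\<bar> powr p * \<phi> s)
      = \<epsilon> * exp (- 1) * (LINT x|M. u0 x) + \<epsilon> * exp (- 1) * (LINT x|M. u1 x)
        + \<epsilon> * (exp (- 1) / R) * (LINT x|M. u0 x)"
    using weak unfolding h bd by (simp add: \<psi>_def algebra_simps)
  \<comment> \<open>All three data terms have the same sign, so two of them may be dropped.\<close>
  moreover have "0 \<le> \<epsilon> * exp (- 1) * (LINT x|M. u1 x)" "0 \<le> \<epsilon> * (exp (- 1) / R) * (LINT x|M. u0 x)"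
    using I0 I1 \<epsilon> R(1) by auto
  ultimately have lower: "\<epsilon> * exp (- 1) * (LINT x|M. u0 x) \<le>
      (LBINT s:{0..R}. LINT x|M. u s x * h s) - (LBINT s:{0..R}. LINT x|M. \<bar>u s x\<bar> powr p * \<phi> s)"
    by linarith

  \<comment> \<open>Pointwise bounds on the integrand\<close>
  define K where "K = {0..R} \<times> (UNIV :: 'g set)"
  \<comment> \<open>The remainder in Young's inequality with b = C/R. It is constant in s and x, so
    over [0,R] \<times> G, of measure R, it integrates to R * D.\<close>
  define D where "D = (C / R) powr (p / (p - 1))"
  have K_sub: "K \<subseteq> time_interval T \<times> UNIV"
    using R(2) by (auto simp: time_interval_def K_def) (meson ereal_less_eq(3) le_less_trans)
  have K_sets [measurable]: "K \<in> sets (lborel \<Otimes>\<^sub>M M)"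
    unfolding K_def space_M[symmetric] by (intro pair_measureI) auto
  have Lp: "u \<in> Lp_loc M p T"
    using sol by (simp add: energy_solution_def)
  have u_meas: "set_borel_measurable (lborel \<Otimes>\<^sub>M M) K (\<lambda>(t, x). u t x)"
    using Lp K_sub set_borel_measurable_subset[OF _ K_sets] unfolding Lp_loc_def by blast
  have up_int: "set_integrable (lborel \<Otimes>\<^sub>M M) K (\<lambda>(t, x). \<bar>u t x\<bar> powr p)"
    using Lp K_sub cpt compact_Times[OF compact_Icc cpt] unfolding Lp_loc_def K_def by blast
  have const_int: "set_integrable (lborel \<Otimes>\<^sub>M M) K (\<lambda>_. D')" for D' :: real
  proof -
    have "emeasure (lborel \<Otimes>\<^sub>M M) K < \<infinity>"
      using sigma_finite_measure.emeasure_pair_measure_Times[OF M_sigma_finite,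
          of "{0..R}" lborel "space M"] R(1) emeasure_space_1
      by (simp add: K_def space_M[symmetric])
    then show ?thesis
      unfolding set_integrable_def
      by (intro integrable_scaleR_left integrable_real_indicator K_sets)
  qed
  have cont: "continuous_on UNIV (\<lambda>s. flat_exp P (1 - s / R))" for P
    using DERIV_flat_scaled by (meson DERIV_isCont continuous_at_imp_continuous_on)
  have \<phi>_meas [measurable]: "\<phi> \<in> borel_measurable borel" and h_meas [measurable]: "h \<in> borel_measurable borel"
    unfolding \<phi>_def[abs_def] h_def[abs_def]
    by (intro borel_measurable_continuous_onI continuous_intros cont; use R in simp)+
  have \<phi>_bd: "0 \<le> \<phi> s" "\<phi> s \<le> 1" for s
    by (auto simp: \<phi>_def flat_exp_def)
  \<comment> \<open>The second derivative contributes a factor 1/R^2, which R \<ge> 1 allows to be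
    replaced by 1/R.\<close>
  have h_bd: "\<bar>h s\<bar> \<le> C / R * \<phi> s powr (1 / p)" for s
  proof -
    have "\<bar>h s\<bar> \<le> \<bar>flat_exp (flat_deriv (flat_deriv 1)) (1 - s / R)\<bar> / R\<^sup>2
        + \<bar>flat_exp (flat_deriv 1) (1 - s / R)\<bar> / R"
      using abs_triangle_ineq[of "flat_exp (flat_deriv (flat_deriv 1)) (1 - s / R) / R\<^sup>2"
          "flat_exp (flat_deriv 1) (1 - s / R) / R"] R(1) by (simp add: h_def)
    also have "\<dots> \<le> (C2 * \<phi> s powr (1 / p)) / R + (C1 * \<phi> s powr (1 / p)) / R"
    proof (intro add_mono frac_le)
      show "R \<le> R\<^sup>2" using R(1) by (simp add: power2_eq_square)
    qed (use R C1 C2 in \<open>auto simp: \<phi>_def\<close>)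
    also have "\<dots> = C / R * \<phi> s powr (1 / p)"
      by (simp add: C_def distrib_right add_divide_distrib)
    finally show ?thesis .
  qed
  \<comment> \<open>Young's inequality with a = |u| \<phi>^(1/p): then a^p is precisely the
    nonlinear integrand and cancels.\<close>
  have young: "u s x * h s - \<bar>u s x\<bar> powr p * \<phi> s \<le> D" for s x
  proof -
    have "u s x * h s \<le> \<bar>u s x\<bar> * \<bar>h s\<bar>"
      by (metis abs_ge_self abs_mult)
    also have "\<dots> \<le> \<bar>u s x\<bar> * (C / R * \<phi> s powr (1 / p))"
      by (intro mult_left_mono h_bd) auto
    also have "\<dots> = (\<bar>u s x\<bar> * \<phi> s powr (1 / p)) * (C / R)"
      by simp
    also have "\<dots> \<le> (\<bar>u s x\<bar> * \<phi> s powr (1 / p)) powr p + D"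
      unfolding D_def using C1 C2 R p by (intro young_weak) (auto simp: C_def)
    also have "(\<bar>u s x\<bar> * \<phi> s powr (1 / p)) powr p = \<bar>u s x\<bar> powr p * \<phi> s"
      using p \<phi>_bd by (simp add: powr_mult powr_powr)
    finally show ?thesis by simp
  qed

  \<comment> \<open>Integrability on the space-time cylinder and comparison of the integrals\<close>
  have int1: "set_integrable (lborel \<Otimes>\<^sub>M M) K (\<lambda>(s, x). u s x * h s)"
  proof (rule set_integrable_bound[OF set_integrable_mult_right[of "C / R", OF set_integral_add(1)[OF const_int[of 1] up_int]]])
    show "set_borel_measurable (lborel \<Otimes>\<^sub>M M) K (\<lambda>(s, x). u s x * h s)"
      using borel_measurable_times[OF u_meas[unfolded set_borel_measurable_def], of "\<lambda>z. h (fst z)"]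
      by (simp add: set_borel_measurable_def case_prod_beta mult.assoc)
    \<comment> \<open>Local integrability is given for |u|^p; Young's inequality with b = 1
      transfers it to u, as \<open>K\<close> has finite measure and \<open>h\<close> is
      bounded.\<close>
    have "\<bar>u s x * h s\<bar> \<le> C / R * (1 + \<bar>u s x\<bar> powr p)" for s x
    proof -
      have "\<bar>u s x\<bar> \<le> 1 + \<bar>u s x\<bar> powr p"
        using young_weak[OF p, of "\<bar>u s x\<bar>" 1] by simp
      moreover have "\<bar>h s\<bar> \<le> C / R"
        using h_bd[of s] mult_left_mono[OF powr_le1[of "1 / p" "\<phi> s"], of "C / R"] \<phi>_bd[of s] p C1 C2 R
        by (simp add: C_def)
      ultimately show ?thesis
        using mult_mono[of "\<bar>h s\<bar>" "C / R" "\<bar>u s x\<bar>" "1 + \<bar>u s x\<bar> powr p"] C1 C2 R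
        by (simp add: abs_mult mult.commute C_def)
    qed
    then show "AE z in lborel \<Otimes>\<^sub>M M. z \<in> K \<longrightarrow> norm (case z of (s, x) \<Rightarrow> u s x * h s)
        \<le> norm (C / R * (1 + (case z of (s, x) \<Rightarrow> \<bar>u s x\<bar> powr p)))"
      unfolding case_prod_beta real_norm_def by (intro AE_I2 impI order_trans[OF _ abs_ge_self])
  qed
  have int2: "set_integrable (lborel \<Otimes>\<^sub>M M) K (\<lambda>(s, x). \<bar>u s x\<bar> powr p * \<phi> s)"
  proof (rule set_integrable_bound[OF up_int])
    show "set_borel_measurable (lborel \<Otimes>\<^sub>M M) K (\<lambda>(s, x). \<bar>u s x\<bar> powr p * \<phi> s)"
      using borel_measurable_times[OF borel_measurable_integrable[OF up_int[unfolded set_integrable_def]],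
          of "\<lambda>z. \<phi> (fst z)"]
      by (simp add: set_borel_measurable_def case_prod_beta mult.assoc)
    show "AE z in lborel \<Otimes>\<^sub>M M. z \<in> K \<longrightarrow> norm (case z of (s, x) \<Rightarrow> \<bar>u s x\<bar> powr p * \<phi> s)
        \<le> norm (case z of (s, x) \<Rightarrow> \<bar>u s x\<bar> powr p)"
      using \<phi>_bd by (intro AE_I2) (auto simp: abs_mult mult_left_le)
  qed
  \<comment> \<open>On the product measure the two integrals can be subtracted and compared
    pointwise without discussing the inner integrals time by time.\<close>
  have fubini: "(LBINT s:{0..R}. LINT x|M. f s x) = (LINT z:K|(lborel \<Otimes>\<^sub>M M). f (fst z) (snd z))"
    if "set_integrable (lborel \<Otimes>\<^sub>M M) K (\<lambda>(s, x). f s x)" for f :: "real \<Rightarrow> 'g \<Rightarrow> real"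
  proof -
    have "integrable (lborel \<Otimes>\<^sub>M M) (\<lambda>(s, x). indicator {0..R} s * f s x)"
      using that unfolding set_integrable_def K_def
      by (simp add: case_prod_beta' indicator_times)
    from integral_fst'[OF this] show ?thesis
      unfolding set_lebesgue_integral_def K_def by (simp add: case_prod_beta' indicator_times)
  qed
  have "(LBINT s:{0..R}. LINT x|M. u s x * h s) - (LBINT s:{0..R}. LINT x|M. \<bar>u s x\<bar> powr p * \<phi> s)
      = (LINT z:K|(lborel \<Otimes>\<^sub>M M). u (fst z) (snd z) * h (fst z)
          - \<bar>u (fst z) (snd z)\<bar> powr p * \<phi> (fst z))"
    using int1 int2 unfolding fubini[OF int1] fubini[OF int2]
    by (subst set_integral_diff(2)) (auto simp: case_prod_beta')
  also have "\<dots> \<le> (LINT z:K|(lborel \<Otimes>\<^sub>M M). D)"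
    using int1 int2 const_int young
    by (intro set_integral_mono set_integral_diff(1)) (auto simp: case_prod_beta')
  also have "\<dots> = (LBINT s:{0..R}. LINT x|M. D)"
    by (rule fubini[symmetric]) (use const_int in \<open>simp add: case_prod_beta'\<close>)
  also have "\<dots> = R * D"
    using R(1) by (simp add: prob_space set_lebesgue_integral_def)
  finally show ?thesis
    using lower by (simp add: D_def C_def)
qed

section \<open>From the estimate to the lifespan bound\<close>

theorem theorem1p3:
  fixes mul :: "'g::{second_countable_topology,t2_space} \<Rightarrow> 'g \<Rightarrow> 'g"
    and one :: 'g
    and invs :: "'g \<Rightarrow> 'g"
    and A :: "('g, 'e::{real_inner,heine_borel}) chart set"
    and g :: "('g, 'e) metric"
    and M :: "'g measure"
    and p :: real
    and u0 u1 :: "'g \<Rightarrow> real"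
  assumes "compact_lie_group mul one invs A"
    and "riemannian_metric A g" and "bi_invariant mul A g"
    and "normalized_haar mul M"
    and "p > 1"
    and "u0 \<in> H1_space A g M" and "u1 \<in> L2_space M"
    and "AE x in M. 0 \<le> u0 x" and "\<not> (AE x in M. u0 x = 0)"
    and "AE x in M. 0 \<le> u1 x" and "\<not> (AE x in M. u1 x = 0)"
  shows "\<exists>\<epsilon>0>0. \<exists>C>0. \<forall>\<epsilon>. 0 < \<epsilon> \<and> \<epsilon> \<le> \<epsilon>0 \<longrightarrow>
           (\<forall>T u. energy_solution A g M p \<epsilon> u0 u1 T u \<longrightarrow>
              lifespan A g M p \<epsilon> u0 u1 T u < \<infinity> \<and>
              lifespan A g M p \<epsilon> u0 u1 T u \<le> ereal (C * \<epsilon> powr (-(p - 1))))"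
proof -
  interpret prob_space M
    by (rule normalized_haarD[OF assms(4)])
  have group: "smooth_atlas A" "compact (UNIV :: 'g set)"
    using assms(1) by (simp_all add: compact_lie_group_def)
  have u0: "u0 \<in> L2_space M"
    using assms(6) by (simp add: H1_space_def)
  obtain C1 where C1: "C1 \<ge> 0" "\<And>x. \<bar>flat_exp (flat_deriv 1) x\<bar> \<le> C1 * flat_exp 1 x powr (1 / p)"
    using flat_le_powr[OF \<open>p > 1\<close>] by blast
  obtain C2 where C2: "C2 \<ge> 0"
      "\<And>x. \<bar>flat_exp (flat_deriv (flat_deriv 1)) x\<bar> \<le> C2 * flat_exp 1 x powr (1 / p)"
    using flat_le_powr[OF \<open>p > 1\<close>] by blast
  define J where "J = exp (- 1) * (LINT x|M. u0 x)"
  define B where "B = (C1 + C2) powr (p / (p - 1))"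
  \<comment> \<open>The second entry comes from solving \<epsilon> J \<le> B R^(-1/(p-1)) for R. The
    entry 1 makes the claimed bound at least 1 for \<epsilon> \<le> 1, so that every R beyond it
    meets the requirement R \<ge> 1.\<close>
  define C where "C = max 1 ((B / J) powr (p - 1))"
  have "(LINT x|M. u0 x) \<noteq> 0"
    using integral_nonneg_eq_0_iff_AE[OF integrable_L2_space[OF u0] assms(8)] assms(9) by simp
  then have J: "J > 0"
    using integral_nonneg_AE[OF assms(8)] by (simp add: J_def)
  have time_le: "T \<le> ereal (C * \<epsilon> powr (- (p - 1)))"
    if \<epsilon>: "0 < \<epsilon>" "\<epsilon> \<le> 1" and sol: "energy_solution A g M p \<epsilon> u0 u1 T u" for \<epsilon> T u
  proof (rule ccontr)
    assume "\<not> ?thesis"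
    \<comment> \<open>A real \<open>R\<close> strictly between the bound and \<open>T\<close> exists
      even when \<open>T\<close> is infinite.\<close>
    then obtain R where R: "C * \<epsilon> powr (- (p - 1)) < R" "ereal R < T"
      using ereal_dense2[of "ereal (C * \<epsilon> powr (- (p - 1)))" T] by (auto simp: not_le)
    have pw: "1 \<le> \<epsilon> powr (- (p - 1))"
      using \<epsilon> \<open>p > 1\<close> powr_mono2'[of "- (p - 1)" \<epsilon> 1] by simp
    then have "1 \<le> C * \<epsilon> powr (- (p - 1))"
      using mult_mono[of 1 C 1 "\<epsilon> powr (- (p - 1))"] by (simp add: C_def)
    with R have R1: "1 \<le> R" by simp
    have "\<epsilon> * J \<le> R * ((C1 + C2) / R) powr (p / (p - 1))"
      using test_function_estimate[OF group assms(2,4,5) \<epsilon>(1) assms(8,10) sol R1 R(2) C1 C2]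
      by (simp add: J_def algebra_simps)
    also have "\<dots> = B * (R * R powr - (p / (p - 1)))"
      using R1 C1 C2 by (simp add: B_def powr_divide powr_minus_divide)
    also have "R * R powr - (p / (p - 1)) = R powr (1 - p / (p - 1))"
      using R1 powr_mult_base[of R "- (p / (p - 1))"] by simp
    also have "1 - p / (p - 1) = - (1 / (p - 1))"
      using \<open>p > 1\<close> by (simp add: field_simps)
    finally have "R powr (1 / (p - 1)) \<le> B / J / \<epsilon>"
      using R1 J \<epsilon> by (simp add: powr_minus_divide field_simps)
    then have "(R powr (1 / (p - 1))) powr (p - 1) \<le> (B / J / \<epsilon>) powr (p - 1)"
      using \<open>p > 1\<close> by (intro powr_mono2) auto
    moreover have "(B / J / \<epsilon>) powr (p - 1) = (B / J) powr (p - 1) / \<epsilon> powr (p - 1)"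
      by (rule powr_divide)
    moreover have "(R powr (1 / (p - 1))) powr (p - 1) = R"
      using \<open>p > 1\<close> R1 by (simp add: powr_powr)
    ultimately have "R \<le> (B / J) powr (p - 1) * \<epsilon> powr (- (p - 1))"
      unfolding powr_minus_divide by simp
    also have "\<dots> \<le> C * \<epsilon> powr (- (p - 1))"
      by (intro mult_right_mono) (auto simp: C_def)
    finally show False using R(1) by simp
  qed
  \<comment> \<open>Each time in the supremum is the existence time of an extension that is itself
    an energy solution, so \<open>time_le\<close> applies to it.\<close>
  have life_le: "lifespan A g M p \<epsilon> u0 u1 T u \<le> ereal (C * \<epsilon> powr (- (p - 1)))"
    if "0 < \<epsilon>" "\<epsilon> \<le> 1" for \<epsilon> T u
    unfolding lifespan_def by (rule Sup_least) (use that time_le in blast)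
  have "lifespan A g M p \<epsilon> u0 u1 T u < \<infinity>" if "0 < \<epsilon>" "\<epsilon> \<le> 1" for \<epsilon> T u
    by (rule le_less_trans[OF life_le[OF that]]) simp
  moreover have "C > 0"
    by (simp add: C_def)
  \<comment> \<open>The threshold for \<epsilon> is 1.\<close>
  ultimately show ?thesis
    using life_le zero_less_one by blast
qed

end
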